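(* Let $n\ge 3$ be an integer and let $D_n$ be the least common multiple of $1,2,\ldots,n$. Then $$\mathrm{pp}(n)=\sum_{(\ell_1,\ldots,\ell_n)\in\mathbf A_n}\ \prod_{s=2}^{n}\ \sum_{\substack{i_s,j_s\ge 0\\ \frac{i_sD_n}{s}+j_s=\ell_s}}(-1)^{i_s}\binom{s}{i_s}\binom{j_s+s-1}{j_s},$$ where $\mathbf A_n=\{(\ell_1,\ldots,\ell_n)\in\mathbb N^n:\ \ell_1+2\ell_2+\cdots+n\ell_n=n\}$ and the innermost sum runs over pairs of nonnegative integers $(i_s,j_s)$ with $\frac{i_sD_n}{s}+j_s=\ell_s$.
   Context: $\mathbb N=\{0,1,2,\ldots\}$. A plane partition of $n$ is an array $(n_{ij})_{i,j\in\{1,\ldots,n\}}$ of nonnegative integers with $\sum_{i,j}n_{ij}=n$ and $n_{ij}\ge n_{i'j'}$ whenever $i\le i'$ and $j\le j'$; $\mathrm{pp}(n)$ denotes the number of plane partitions of $n$. *)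

theory Defs
  imports Complex_Main "HOL-Library.FuncSet"
begin

text \<open>
  Arrays indexed by \<open>{1..n} \<times> {1..n}\<close> and tuples indexed by \<open>{1..n}\<close> are extensional functions
  (undefined outside the index set), so that each array or tuple is represented exactly once.
\<close>

definition plane_partitions :: "nat \<Rightarrow> (nat \<times> nat \<Rightarrow> nat) set" where
  "plane_partitions n =
     {p \<in> {1..n} \<times> {1..n} \<rightarrow>\<^sub>E UNIV.
        (\<Sum>(i, j)\<in>{1..n} \<times> {1..n}. p (i, j)) = n \<and>
        (\<forall>i\<in>{1..n}. \<forall>j\<in>{1..n}. \<forall>i'\<in>{1..n}. \<forall>j'\<in>{1..n}.
           i \<le> i' \<and> j \<le> j' \<longrightarrow> p (i, j) \<ge> p (i', j'))}"

definition pp :: "nat \<Rightarrow> nat" where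
  "pp n = card (plane_partitions n)"

definition D :: "nat \<Rightarrow> nat" where
  "D n = Lcm {1..n}"

definition A :: "nat \<Rightarrow> (nat \<Rightarrow> nat) set" where
  "A n = {l \<in> {1..n} \<rightarrow>\<^sub>E UNIV. (\<Sum>s = 1..n. s * l s) = n}"

text \<open>
  The division is taken in the rationals, so no rounding convention is involved.
\<close>

definition index_pairs :: "nat \<Rightarrow> nat \<Rightarrow> nat \<Rightarrow> (nat \<times> nat) set" where
  "index_pairs n s m =
     {(i, j). (of_nat (i * D n) / of_nat s + of_nat j :: rat) = of_nat m}"

end

theory Submission
  imports Defs "HOL-Library.Multiset"
begin

text \<open>
  Since \<open>D n \<ge> n (n - 1) > n\<close>, only \<open>i = 0\<close> contributes to the inner sums, and the claim becomes
  MacMahon's formula for plane partitions, with \<open>1 / (1 - x^s)^s\<close> expanded. MacMahon's formula is proved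
  by the piecewise-linear toggle bijection between arbitrary fillings of a Young diagram and
  its reverse plane partitions, built up corner by corner. Adding a corner toggles the entries on
  its diagonal, and this makes the diagonal sum ending at a boundary cell \<open>(x, y)\<close> equal to
  the sum of the filling over the rectangle \<open>{1..x} \<times> {1..y}\<close>. Summing over all diagonals of a
  square, each cell is counted with its hook length, and there are \<open>s\<close> cells of hook
  length \<open>s\<close> for \<open>s \<le> n\<close>.
\<close>

subsection \<open>Toggling a diagonal\<close>

definition young :: "(nat \<times> nat) set \<Rightarrow> bool" where
  "young S \<longleftrightarrow> finite S \<and> (\<forall>i j. (i, j) \<in> S \<longrightarrow> 1 \<le> i \<and> 1 \<le> j) \<and>
     (\<forall>i j i' j'. (i, j) \<in> S \<longrightarrow> 1 \<le> i' \<longrightarrow> i' \<le> i \<longrightarrow> 1 \<le> j' \<longrightarrow> j' \<le> j \<longrightarrow> (i', j') \<in> S)"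

definition fillings :: "'a set \<Rightarrow> ('a \<Rightarrow> nat) set" where
  "fillings S = {f. \<forall>c. c \<notin> S \<longrightarrow> f c = 0}"

text \<open>
  Row and column \<open>0\<close> lie outside every Young diagram, so that fillings vanish there and the
  boundary cells need no separate treatment.
\<close>

definition rpp :: "(nat \<times> nat) set \<Rightarrow> (nat \<times> nat \<Rightarrow> nat) set" where
  "rpp S = {f \<in> fillings S.
     (\<forall>i j. (Suc i, j) \<in> S \<longrightarrow> f (i, j) \<le> f (Suc i, j)) \<and>
     (\<forall>i j. (i, Suc j) \<in> S \<longrightarrow> f (i, j) \<le> f (i, Suc j))}"

text \<open>The trace of the diagonal that ends at \<open>(x, y)\<close>. The recursion stops on row
  or column \<open>0\<close>, where fillings vanish anyway.\<close>

fun diag :: "(nat \<times> nat \<Rightarrow> nat) \<Rightarrow> nat \<Rightarrow> nat \<Rightarrow> nat" where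
  "diag f 0 y = 0"
| "diag f (Suc x) 0 = 0"
| "diag f (Suc x) (Suc y) = f (Suc x, Suc y) + diag f x y"

text \<open>The cells strictly north-west of \<open>(a, b)\<close> on its diagonal.\<close>

definition inner :: "nat \<Rightarrow> nat \<Rightarrow> nat \<Rightarrow> nat \<Rightarrow> bool" where
  "inner a b i j \<longleftrightarrow> 1 \<le> i \<and> 1 \<le> j \<and> i < a \<and> i + b = j + a"

text \<open>Reflects each inner value in the interval between the max of its upper and left
  neighbours and the min of its lower and right ones. Inner cells are never adjacent, so all are
  reflected at once.\<close>

definition toggle :: "nat \<Rightarrow> nat \<Rightarrow> (nat \<times> nat \<Rightarrow> nat) \<Rightarrow> nat \<times> nat \<Rightarrow> nat" where
  "toggle a b f = (\<lambda>(i, j). if inner a b i j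
     then max (f (i - 1, j)) (f (i, j - 1)) + min (f (Suc i, j)) (f (i, Suc j)) - f (i, j)
     else f (i, j))"

text \<open>The slack \<open>v\<close> is the excess of the new corner over the least value that its
  neighbours allow, so any natural number is possible.\<close>

definition add_corner :: "nat \<Rightarrow> nat \<Rightarrow> (nat \<times> nat \<Rightarrow> nat) \<Rightarrow> nat \<Rightarrow> nat \<times> nat \<Rightarrow> nat" where
  "add_corner a b f v = (toggle a b f)((a, b) := max (f (a - 1, b)) (f (a, b - 1)) + v)"

definition remove_corner :: "nat \<Rightarrow> nat \<Rightarrow> (nat \<times> nat \<Rightarrow> nat) \<Rightarrow> nat \<times> nat \<Rightarrow> nat" where
  "remove_corner a b g = (toggle a b g)((a, b) := 0)"

lemma toggle_inner:
  "inner a b i j \<Longrightarrow> toggle a b f (i, j) =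
     max (f (i - 1, j)) (f (i, j - 1)) + min (f (Suc i, j)) (f (i, Suc j)) - f (i, j)"
  by (simp add: toggle_def)

lemma toggle_not_inner: "\<not> inner a b i j \<Longrightarrow> toggle a b f (i, j) = f (i, j)"
  by (simp add: toggle_def)

lemma not_inner_neighbours:
  assumes "inner a b i j"
  shows "\<not> inner a b (i - 1) j" "\<not> inner a b i (j - 1)"
    "\<not> inner a b (Suc i) j" "\<not> inner a b i (Suc j)"
  using assms by (auto simp: inner_def)

lemma corner_neighbours_not_inner:
  assumes "1 \<le> a" "1 \<le> b"
  shows "\<not> inner a b a b" "\<not> inner a b (a - 1) b" "\<not> inner a b a (b - 1)"
  using assms by (auto simp: inner_def)

lemma young_down:
  assumes "young S" "(i, j) \<in> S" "1 \<le> i'" "i' \<le> i" "1 \<le> j'" "j' \<le> j"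
  shows "(i', j') \<in> S"
  using assms unfolding young_def by blast

lemma young_pos: "young S \<Longrightarrow> (i, j) \<in> S \<Longrightarrow> 1 \<le> i \<and> 1 \<le> j"
  unfolding young_def by blast

lemma rpp_fillings: "f \<in> rpp S \<Longrightarrow> f \<in> fillings S"
  by (simp add: rpp_def)

lemma fillings_outside: "f \<in> fillings S \<Longrightarrow> c \<notin> S \<Longrightarrow> f c = 0"
  by (simp add: fillings_def)

lemma rpp_down: "f \<in> rpp S \<Longrightarrow> (Suc i, j) \<in> S \<Longrightarrow> f (i, j) \<le> f (Suc i, j)"
  by (simp add: rpp_def)

lemma rpp_right: "f \<in> rpp S \<Longrightarrow> (i, Suc j) \<in> S \<Longrightarrow> f (i, j) \<le> f (i, Suc j)"
  by (simp add: rpp_def)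

definition interlaced :: "nat \<Rightarrow> nat \<Rightarrow> (nat \<times> nat \<Rightarrow> nat) \<Rightarrow> bool" where
  "interlaced a b f \<longleftrightarrow> (\<forall>i j. inner a b i j \<longrightarrow>
     max (f (i - 1, j)) (f (i, j - 1)) \<le> f (i, j) \<and>
     f (i, j) \<le> min (f (Suc i, j)) (f (i, Suc j)))"

text \<open>The cells read by a toggle are not toggled themselves, so the second application sees
  the same max and min and reflects back. Interlacing keeps the subtraction from truncating.\<close>

lemma toggle_toggle:
  assumes "interlaced a b f"
  shows "toggle a b (toggle a b f) = f"
proof
  fix c :: "nat \<times> nat"
  obtain i j where c: "c = (i, j)" by force
  show "toggle a b (toggle a b f) c = f c"
  proof (cases "inner a b i j")
    case True
    have "max (f (i - 1, j)) (f (i, j - 1)) \<le> f (i, j)" "f (i, j) \<le> min (f (Suc i, j)) (f (i, Suc j))"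
      using assms True unfolding interlaced_def by auto
    moreover have "toggle a b (toggle a b f) (i, j) = max (f (i - 1, j)) (f (i, j - 1)) +
        min (f (Suc i, j)) (f (i, Suc j)) -
        (max (f (i - 1, j)) (f (i, j - 1)) + min (f (Suc i, j)) (f (i, Suc j)) - f (i, j))"
      by (simp only: toggle_inner[OF True] not_inner_neighbours[OF True, THEN toggle_not_inner])
    ultimately show ?thesis unfolding c by (simp only: diff_diff_cancel trans_le_add2)
  next
    case False
    then show ?thesis by (simp add: c toggle_not_inner)
  qed
qed

section \<open>Adding and removing a corner of a Young diagram\<close>

locale corner =
  fixes S :: "(nat \<times> nat) set" and a b :: nat
  assumes young: "young S" and young': "young (insert (a, b) S)" and new: "(a, b) \<notin> S"
begin

lemma pos: "1 \<le> a" "1 \<le> b"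
  using young_pos[OF young'] by auto

lemma below:
  assumes "1 \<le> i" "i \<le> a" "1 \<le> j" "j \<le> b" "(i, j) \<noteq> (a, b)"
  shows "(i, j) \<in> S"
  using young_down[OF young', of a b i j] assms by auto

lemma inner_mem:
  assumes "inner a b i j"
  shows "(i, j) \<in> S" "(Suc i, j) \<in> S" "(i, Suc j) \<in> S"
  using assms by (auto simp: inner_def intro!: below)

text \<open>\<open>U\<close> is kept general because it is \<open>S\<close> when the corner is added
  and \<open>insert (a, b) S\<close> when it is removed.\<close>

lemma interlaced:
  assumes f: "f \<in> rpp U" and U: "S \<subseteq> U"
  shows "interlaced a b f"
  unfolding interlaced_def
proof (intro allI impI)
  fix i j assume ij: "inner a b i j"
  then have p: "1 \<le> i" "1 \<le> j" by (auto simp: inner_def)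
  have m: "(Suc (i - 1), j) \<in> U" "(i, Suc (j - 1)) \<in> U" "(Suc i, j) \<in> U" "(i, Suc j) \<in> U"
    using inner_mem[OF ij] U p by auto
  show "max (f (i - 1, j)) (f (i, j - 1)) \<le> f (i, j) \<and>
     f (i, j) \<le> min (f (Suc i, j)) (f (i, Suc j))"
    using rpp_down[OF f m(1)] rpp_right[OF f m(2)] rpp_down[OF f m(3)] rpp_right[OF f m(4)] p
    by auto
qed

text \<open>Of two adjacent cells at most one is inner. Its reflected value stays between its max
  and min, hence weakly above its smaller neighbours and weakly below its larger ones, which do not
  move.\<close>

lemma toggle_mono:
  assumes f: "f \<in> rpp U" and U: "S \<subseteq> U"
  shows "(Suc i, j) \<in> U \<Longrightarrow> 1 \<le> j \<Longrightarrow> toggle a b f (i, j) \<le> toggle a b f (Suc i, j)"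
    and "(i, Suc j) \<in> U \<Longrightarrow> 1 \<le> i \<Longrightarrow> toggle a b f (i, j) \<le> toggle a b f (i, Suc j)"
proof -
  have il: "max (f (k - 1, l)) (f (k, l - 1)) \<le> f (k, l)"
    "f (k, l) \<le> min (f (Suc k, l)) (f (k, Suc l))" if "inner a b k l" for k l
    using interlaced[OF assms] that unfolding interlaced_def by auto
  show "toggle a b f (i, j) \<le> toggle a b f (Suc i, j)" if "(Suc i, j) \<in> U" "1 \<le> j"
  proof -
    consider "inner a b i j" | "inner a b (Suc i) j" | "\<not> inner a b i j" "\<not> inner a b (Suc i) j" by blast
    then show ?thesis
    proof cases
      case 1
      then show ?thesis using il[OF 1] not_inner_neighbours[OF 1]
        by (auto simp: toggle_inner toggle_not_inner max_def min_def)
    next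
      case 2
      then show ?thesis using il[OF 2] not_inner_neighbours[OF 2]
        by (auto simp: toggle_inner toggle_not_inner max_def min_def)
    next
      case 3
      then show ?thesis using rpp_down[OF f that(1)] by (simp add: toggle_not_inner)
    qed
  qed
  show "toggle a b f (i, j) \<le> toggle a b f (i, Suc j)" if "(i, Suc j) \<in> U" "1 \<le> i"
  proof -
    consider "inner a b i j" | "inner a b i (Suc j)" | "\<not> inner a b i j" "\<not> inner a b i (Suc j)" by blast
    then show ?thesis
    proof cases
      case 1
      then show ?thesis using il[OF 1] not_inner_neighbours[OF 1]
        by (auto simp: toggle_inner toggle_not_inner max_def min_def)
    next
      case 2
      then show ?thesis using il[OF 2] not_inner_neighbours[OF 2]
        by (auto simp: toggle_inner toggle_not_inner max_def min_def)
    next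
      case 3
      then show ?thesis using rpp_right[OF f that(1)] by (simp add: toggle_not_inner)
    qed
  qed
qed

lemma toggle_fillings:
  assumes "f \<in> fillings U" "S \<subseteq> U"
  shows "toggle a b f \<in> fillings U"
  unfolding fillings_def
proof (intro CollectI allI impI)
  fix c assume c: "c \<notin> U"
  obtain i j where ij: "c = (i, j)" by force
  have "\<not> inner a b i j" using inner_mem(1) c assms(2) ij by blast
  then show "toggle a b f c = 0" using c assms(1) by (simp add: ij toggle_not_inner fillings_outside)
qed

lemma add_corner_rpp:
  assumes f: "f \<in> rpp S"
  shows "add_corner a b f v \<in> rpp (insert (a, b) S)"
proof -
  let ?g = "add_corner a b f v" and ?t = "toggle a b f"
  have fil: "?g \<in> fillings (insert (a, b) S)"
    using toggle_fillings[OF rpp_fillings[OF f] subset_refl] by (auto simp: fillings_def add_corner_def)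
  have p: "1 \<le> i \<and> 1 \<le> j" if "(i, j) \<in> insert (a, b) S" for i j
    using young_pos[OF young'] that by blast
  have 1: "?g (i, j) \<le> ?g (Suc i, j)" if "(Suc i, j) \<in> insert (a, b) S" for i j
  proof (cases "(Suc i, j) = (a, b)")
    case True
    then show ?thesis using corner_neighbours_not_inner(2)[OF pos]
      by (auto simp: add_corner_def toggle_not_inner)
  next
    case False
    then have s: "(Suc i, j) \<in> S" using that by auto
    \<comment> \<open>Otherwise \<open>(Suc a, b)\<close> would be in \<open>S\<close> and force
      \<open>(a, b)\<close> into \<open>S\<close>.\<close>
    have "(i, j) \<noteq> (a, b)" using young_down[OF young s, of a b] pos new by auto
    then show ?thesis using toggle_mono(1)[OF f subset_refl s] p[OF that] False \<open>(i, j) \<noteq> (a, b)\<close>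
      by (simp add: add_corner_def del: prod.inject)
  qed
  have 2: "?g (i, j) \<le> ?g (i, Suc j)" if "(i, Suc j) \<in> insert (a, b) S" for i j
  proof (cases "(i, Suc j) = (a, b)")
    case True
    then show ?thesis using corner_neighbours_not_inner(3)[OF pos]
      by (auto simp: add_corner_def toggle_not_inner)
  next
    case False
    then have s: "(i, Suc j) \<in> S" using that by auto
    have "(i, j) \<noteq> (a, b)" using young_down[OF young s, of a b] pos new by auto
    then show ?thesis using toggle_mono(2)[OF f subset_refl s] p[OF that] False \<open>(i, j) \<noteq> (a, b)\<close>
      by (simp add: add_corner_def del: prod.inject)
  qed
  show ?thesis unfolding rpp_def using fil 1 2 by blast
qed

lemma remove_corner_rpp:
  assumes g: "g \<in> rpp (insert (a, b) S)"
  shows "remove_corner a b g \<in> rpp S"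
proof -
  let ?f = "remove_corner a b g"
  have fil: "?f \<in> fillings S"
    using toggle_fillings[OF rpp_fillings[OF g]] by (auto simp: fillings_def remove_corner_def)
  have 1: "?f (i, j) \<le> ?f (Suc i, j)" if "(Suc i, j) \<in> S" for i j
    using toggle_mono(1)[OF g, of i j] that new young_pos[OF young that]
    by (auto simp: remove_corner_def)
  have 2: "?f (i, j) \<le> ?f (i, Suc j)" if "(i, Suc j) \<in> S" for i j
    using toggle_mono(2)[OF g, of i j] that new young_pos[OF young that]
    by (auto simp: remove_corner_def)
  show ?thesis unfolding rpp_def using fil 1 2 by blast
qed

text \<open>Neighbours of inner cells lie on adjacent diagonals, so no toggle reads
  \<open>(a, b)\<close>. Hence the corner can be overwritten before or after toggling.\<close>

lemma toggle_upd_corner: "toggle a b (f((a, b) := v)) = (toggle a b f)((a, b) := v)"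
proof (rule ext, clarify)
  fix i j
  have "(i, j) \<noteq> (a, b)" "(i - 1, j) \<noteq> (a, b)" "(i, j - 1) \<noteq> (a, b)" "(Suc i, j) \<noteq> (a, b)" "(i, Suc j) \<noteq> (a, b)"
    if "inner a b i j"
    using that by (auto simp: inner_def)
  moreover have "\<not> inner a b a b" by (simp add: inner_def)
  ultimately show "toggle a b (f((a, b) := v)) (i, j) = ((toggle a b f)((a, b) := v)) (i, j)"
    by (cases "inner a b i j")
      (simp_all only: toggle_inner toggle_not_inner fun_upd_apply if_False, auto simp: toggle_not_inner)
qed

lemma remove_add:
  assumes "f \<in> rpp S"
  shows "remove_corner a b (add_corner a b f v) = f"
    and "add_corner a b f v (a, b) -
      max (add_corner a b f v (a - 1, b)) (add_corner a b f v (a, b - 1)) = v"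
proof -
  have "f (a, b) = 0" using rpp_fillings[OF assms] new by (rule fillings_outside)
  then show "remove_corner a b (add_corner a b f v) = f"
    using toggle_toggle[OF interlaced[OF assms subset_refl]]
    by (auto simp: remove_corner_def add_corner_def toggle_upd_corner)
  show "add_corner a b f v (a, b) -
      max (add_corner a b f v (a - 1, b)) (add_corner a b f v (a, b - 1)) = v"
    using pos corner_neighbours_not_inner[OF pos] by (auto simp: add_corner_def toggle_not_inner)
qed

lemma add_remove:
  assumes "g \<in> rpp (insert (a, b) S)"
  shows "add_corner a b (remove_corner a b g) (g (a, b) - max (g (a - 1, b)) (g (a, b - 1))) = g"
proof -
  \<comment> \<open>These bounds make the slack an exact difference, so adding it back restores
    \<open>g (a, b)\<close>.\<close>
  have "g (a - 1, b) \<le> g (a, b)" "g (a, b - 1) \<le> g (a, b)"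
    using rpp_down[OF assms, of "a - 1" b] rpp_right[OF assms, of a "b - 1"] pos by auto
  then show ?thesis
    using toggle_toggle[OF interlaced[OF assms subset_insertI]] pos corner_neighbours_not_inner[OF pos]
    by (auto simp: remove_corner_def add_corner_def toggle_upd_corner toggle_not_inner)
qed

end

section \<open>Diagonal sums under a toggle\<close>

lemma diag_0_right [simp]: "diag f x 0 = 0"
  by (cases x) auto

lemma diag_cong:
  assumes "\<And>i j. i \<le> x \<Longrightarrow> i + y = j + x \<Longrightarrow> f (i, j) = g (i, j)"
  shows "diag f x y = diag g x y"
  using assms by (induction f x y rule: diag.induct) auto

definition zero_border :: "(nat \<times> nat \<Rightarrow> nat) \<Rightarrow> bool" where
  "zero_border f \<longleftrightarrow> (\<forall>k. f (0, k) = 0 \<and> f (k, 0) = 0)"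

text \<open>The zero border makes this hold at \<open>x = 0\<close> too, where \<open>x - 1\<close>
  is \<open>0\<close> and every term vanishes.\<close>

lemma diag_Suc_right: "zero_border f \<Longrightarrow> diag f x (Suc y) = f (x, Suc y) + diag f (x - 1) y"
  by (cases x) (auto simp: zero_border_def)

lemma diag_Suc_left: "zero_border f \<Longrightarrow> diag f (Suc x) y = f (Suc x, y) + diag f x (y - 1)"
  by (cases y) (auto simp: zero_border_def)

text \<open>Old plus new value of a toggled cell is its max plus its min. The max at a cell and the
  min at its north-west neighbour range over the same two cells, so together they give the sum of
  both. Along the diagonal everything pairs off except the last min.\<close>

lemma diag_toggle:
  assumes "interlaced a b f" "zero_border f" "u + b = v + a" "u < a"
  shows "diag (toggle a b f) u v + diag f u v =
    diag f (u - 1) v + diag f u (v - 1) + min (f (Suc u, v)) (f (u, Suc v))"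
  using assms(3,4)
proof (induction u arbitrary: v)
  case 0
  then show ?case using assms(2) by (simp add: zero_border_def)
next
  case (Suc u)
  show ?case
  proof (cases v)
    case 0
    then show ?thesis using assms(2) by (simp add: zero_border_def)
  next
    case v: (Suc w)
    have i: "inner a b (Suc u) v" using Suc.prems v by (simp add: inner_def)
    \<comment> \<open>\<open>A\<close> and \<open>B\<close> are the max and min at the current cell,
      \<open>B'\<close> the min at its north-west neighbour; \<open>A + B' = p + q\<close> is the
      pairing, and \<open>f0 \<le> B\<close> makes the subtraction exact.\<close>
    have arith: "T + d' + (f0 + d) = (p + d1) + (q + d2) + B"
      if "f0 \<le> B" "T = A + B - f0" "A + B' = p + q" "d' + d = d1 + d2 + B'"
      for T d' f0 d p d1 q d2 A B B' :: nat
      using that by linarith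
    have "f (Suc u, v) \<le> min (f (Suc (Suc u), v)) (f (Suc u, Suc v))"
      using assms(1) i unfolding interlaced_def by blast
    moreover have "toggle a b f (Suc u, v) = max (f (u, v)) (f (Suc u, w)) +
        min (f (Suc (Suc u), v)) (f (Suc u, Suc v)) - f (Suc u, v)"
      using toggle_inner[OF i, of f] v by simp
    moreover have "max (f (u, v)) (f (Suc u, w)) + min (f (Suc u, w)) (f (u, v)) = f (u, v) + f (Suc u, w)"
      by simp
    moreover have "diag (toggle a b f) u w + diag f u w =
        diag f (u - 1) w + diag f u (w - 1) + min (f (Suc u, w)) (f (u, v))"
      using Suc.IH[of w] Suc.prems v by simp
    ultimately have "toggle a b f (Suc u, v) + diag (toggle a b f) u w + (f (Suc u, v) + diag f u w) =
        (f (u, v) + diag f (u - 1) w) + (f (Suc u, w) + diag f u (w - 1)) +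
        min (f (Suc (Suc u), v)) (f (Suc u, Suc v))"
      by (rule arith)
    moreover have "diag f u v = f (u, v) + diag f (u - 1) w"
      "diag f (Suc u) w = f (Suc u, w) + diag f u (w - 1)"
      using diag_Suc_right[OF assms(2)] diag_Suc_left[OF assms(2)] v by simp_all
    ultimately show ?thesis using v by simp
  qed
qed

context corner
begin

lemma below_or_border:
  assumes "i \<le> a" "j \<le> b" "(i, j) \<noteq> (a, b)"
  shows "(i, j) \<in> S \<or> i = 0 \<or> j = 0"
proof (cases "i = 0 \<or> j = 0")
  case False
  then show ?thesis using below[of i j] assms by simp
qed auto

lemma fillings_zero_border: "f \<in> fillings (insert (a, b) S) \<Longrightarrow> zero_border f"
  using young_pos[OF young'] unfolding fillings_def zero_border_def by fastforce

text \<open>The max used for the corner absorbs the min left over by \<open>diag_toggle\<close>. The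
  result has the form of inclusion-exclusion for rectangle sums, with \<open>v\<close> as the entry
  at \<open>(a, b)\<close>.\<close>

lemma diag_add_corner:
  assumes f: "f \<in> rpp S"
  shows "diag (add_corner a b f v) a b + diag f (a - 1) (b - 1) =
    v + diag f (a - 1) b + diag f a (b - 1)"
proof -
  obtain a' b' where ab: "a = Suc a'" "b = Suc b'"
    using pos by (auto simp: Suc_le_eq gr0_conv_Suc)
  have "f \<in> fillings (insert (a, b) S)" using rpp_fillings[OF f] by (simp add: fillings_def)
  then have z: "zero_border f" by (rule fillings_zero_border)
  have "diag (add_corner a b f v) a' b' = diag (toggle a b f) a' b'"
    by (rule diag_cong) (auto simp: add_corner_def ab)
  moreover have "diag (toggle a b f) a' b' + diag f a' b' =
      diag f (a' - 1) b' + diag f a' (b' - 1) + min (f (a, b')) (f (a', b))"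
    using diag_toggle[OF interlaced[OF f subset_refl] z, of a' b'] by (simp add: ab)
  moreover have "add_corner a b f v (a, b) = max (f (a', b)) (f (a, b')) + v"
    by (simp add: add_corner_def ab)
  moreover have "diag f a' b = f (a', b) + diag f (a' - 1) b'"
    "diag f a b' = f (a, b') + diag f a' (b' - 1)"
    using diag_Suc_right[OF z] diag_Suc_left[OF z] by (simp_all add: ab)
  ultimately show ?thesis by (simp add: ab)
qed

lemma diag_add_corner_off:
  assumes "x + b \<noteq> y + a"
  shows "diag (add_corner a b f v) x y = diag f x y"
  using assms by (intro diag_cong) (auto simp: add_corner_def toggle_def inner_def)

end

text \<open>A cell with maximal \<open>i + j\<close> is dominated by no other cell, so removing it
  leaves a Young diagram.\<close>

lemma young_remove_corner:
  assumes "young S" "S \<noteq> {}"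
  obtains a b where "(a, b) \<in> S" "young (S - {(a, b)})"
proof -
  have fin: "finite S" using assms(1) by (simp add: young_def)
  define M where "M = Max ((\<lambda>(i, j). i + j) ` S)"
  have "M \<in> (\<lambda>(i, j). i + j) ` S" unfolding M_def using fin assms(2) by (intro Max_in) auto
  then obtain a b where ab: "(a, b) \<in> S" "a + b = M" by auto
  have le: "i + j \<le> M" if "(i, j) \<in> S" for i j
    unfolding M_def using fin that by (intro Max_ge) auto
  have "young (S - {(a, b)})"
    unfolding young_def
  proof (intro conjI allI impI)
    fix i j i' j'
    assume *: "(i, j) \<in> S - {(a, b)}" "1 \<le> i'" "i' \<le> i" "1 \<le> j'" "j' \<le> j"
    have "(i', j') \<in> S" using young_down[OF assms(1), of i j i' j'] * by auto
    moreover have "(i', j') \<noteq> (a, b)" using * le[of i j] ab(2) by auto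
    ultimately show "(i', j') \<in> S - {(a, b)}" by auto
  qed (use fin young_pos[OF assms(1)] in auto)
  then show thesis using that ab by blast
qed

subsection \<open>The toggle bijection\<close>

lemma corner_rectangle_sum:
  fixes m :: "nat \<times> nat \<Rightarrow> nat"
  assumes "1 \<le> a" "1 \<le> b"
  shows "sum m ({1..a} \<times> {1..b}) + sum m ({1..a - 1} \<times> {1..b - 1}) =
    m (a, b) + sum m ({1..a - 1} \<times> {1..b}) + sum m ({1..a} \<times> {1..b - 1})"
proof -
  obtain a' b' where ab: "a = Suc a'" "b = Suc b'"
    using assms by (auto simp: Suc_le_eq gr0_conv_Suc)
  have c: "sum m (X \<times> Y) = (\<Sum>i\<in>X. \<Sum>j\<in>Y. m (i, j))" for X Y
    by (simp add: sum.cartesian_product)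
  show ?thesis by (simp add: ab c sum.distrib)
qed

text \<open>Induction over the cells; the entry of the filling at the last corner becomes its slack.
  The claim on diagonals concerns cells that end their diagonal. Border cells are included because a
  corner in the first row or column has neighbours there.\<close>

theorem fillings_rpp_bij:
  assumes "young S"
  shows "\<exists>\<Psi>. bij_betw \<Psi> (fillings S) (rpp S) \<and>
    (\<forall>m\<in>fillings S. \<forall>x y. (x, y) \<in> S \<or> x = 0 \<or> y = 0 \<longrightarrow> (Suc x, Suc y) \<notin> S \<longrightarrow>
       diag (\<Psi> m) x y = sum m ({1..x} \<times> {1..y}))"
  using assms
proof (induction "card S" arbitrary: S)
  case 0
  then have S: "S = {}" by (simp add: young_def)
  have e: "rpp {} = fillings {}" by (auto simp: rpp_def fillings_def)
  have "diag f x 0 = 0" "diag f 0 y = 0" for f x y by simp_all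
  then show ?case unfolding S e by (intro exI[of _ id]) (auto simp: bij_betw_def)
next
  case (Suc k T)
  then have "T \<noteq> {}" by auto
  then obtain a b where ab: "(a, b) \<in> T" "young (T - {(a, b)})"
    using young_remove_corner[OF Suc.prems] by blast
  define S where "S = T - {(a, b)}"
  have T: "T = insert (a, b) S" using ab S_def by auto
  interpret corner S a b
    using ab Suc.prems by unfold_locales (auto simp: S_def insert_absorb)
  have "k = card S" using Suc.hyps(2) ab(1) by (simp add: S_def)
  then obtain \<Psi> where bij: "bij_betw \<Psi> (fillings S) (rpp S)"
    and diag: "\<And>m x y. m \<in> fillings S \<Longrightarrow> (x, y) \<in> S \<or> x = 0 \<or> y = 0 \<Longrightarrow> (Suc x, Suc y) \<notin> S \<Longrightarrow>
       diag (\<Psi> m) x y = sum m ({1..x} \<times> {1..y})"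
    using Suc.hyps(1)[OF _ young] by blast
  define \<Theta> where "\<Theta> = inv_into (fillings S) \<Psi>"
  \<comment> \<open>\<open>\<Psi>'\<close> strips the corner entry, maps the rest by
    \<open>\<Psi>\<close> and adds the corner with that entry as slack; \<open>\<Theta>'\<close>
    undoes this.\<close>
  define \<Psi>' where "\<Psi>' m = add_corner a b (\<Psi> (m((a, b) := 0))) (m (a, b))" for m
  define \<Theta>' where "\<Theta>' g = (\<Theta> (remove_corner a b g))((a, b) := g (a, b) - max (g (a - 1, b)) (g (a, b - 1)))" for g
  have low: "m((a, b) := 0) \<in> fillings S" if "m \<in> fillings T" for m
    using that by (auto simp: fillings_def T)
  have \<Psi>: "\<Psi> m \<in> rpp S" if "m \<in> fillings S" for m
    using bij that by (auto simp: bij_betw_def)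
  have \<Theta>: "\<Theta> f \<in> fillings S" "\<Psi> (\<Theta> f) = f" if "f \<in> rpp S" for f
    using bij_betwE[OF bij_betw_inv_into[OF bij]] bij_betw_inv_into_right[OF bij] that
    unfolding \<Theta>_def by simp_all
  have \<Theta>\<Psi>: "\<Theta> (\<Psi> m) = m" if "m \<in> fillings S" for m
    using bij that unfolding \<Theta>_def by (rule bij_betw_inv_into_left)
  have "bij_betw \<Psi>' (fillings T) (rpp T)"
  proof (rule bij_betw_byWitness[where f' = \<Theta>'])
    show "\<forall>m\<in>fillings T. \<Theta>' (\<Psi>' m) = m"
      using remove_add[OF \<Psi>[OF low]] \<Theta>\<Psi>[OF low] by (simp add: \<Theta>'_def \<Psi>'_def)
    show "\<Psi>' ` fillings T \<subseteq> rpp T"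
      using add_corner_rpp[OF \<Psi>[OF low]] by (auto simp: \<Psi>'_def T)
    show "\<Theta>' ` rpp T \<subseteq> fillings T"
      using \<Theta>(1)[OF remove_corner_rpp] by (auto simp: \<Theta>'_def T fillings_def)
    have "(\<Theta> (remove_corner a b g))((a, b) := 0) = \<Theta> (remove_corner a b g)" if "g \<in> rpp T" for g
      using fillings_outside[OF \<Theta>(1)[OF remove_corner_rpp] new] that by (auto simp: T)
    then show "\<forall>g\<in>rpp T. \<Psi>' (\<Theta>' g) = g"
      using add_remove \<Theta>(2)[OF remove_corner_rpp] by (simp add: \<Theta>'_def \<Psi>'_def T)
  qed
  moreover have "diag (\<Psi>' m) x y = sum m ({1..x} \<times> {1..y})"
    if m: "m \<in> fillings T" and xy: "(x, y) \<in> T \<or> x = 0 \<or> y = 0" "(Suc x, Suc y) \<notin> T" for m x y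
  proof -
    define m0 where "m0 = m((a, b) := 0)"
    have m0: "m0 \<in> fillings S" using low[OF m] by (simp add: m0_def)
    \<comment> \<open>Such a rectangle is empty or ends in \<open>S\<close>, so it misses
      \<open>(a, b)\<close>, and \<open>m0\<close> and \<open>m\<close> have the same sum over
      it.\<close>
    have rect: "diag (\<Psi> m0) u v = sum m ({1..u} \<times> {1..v})"
      if "(u, v) \<in> S \<or> u = 0 \<or> v = 0" "(Suc u, Suc v) \<notin> S" for u v
    proof -
      have "(a, b) \<notin> {1..u} \<times> {1..v}"
        using that(1) young_down[OF young, of u v a b] new by auto
      then have "sum m0 ({1..u} \<times> {1..v}) = sum m ({1..u} \<times> {1..v})"
        by (intro sum.cong) (auto simp: m0_def)
      then show ?thesis using diag[OF m0 that] by simp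
    qed
    consider "x = 0 \<or> y = 0" | "(x, y) = (a, b)" | "(x, y) \<in> S" "x + b = y + a" | "(x, y) \<in> S" "x + b \<noteq> y + a"
      using xy(1) T by auto
    then show ?thesis
    proof cases
      case 1
      then show ?thesis by auto
    next
      case 2
      \<comment> \<open>Since these cells are not in \<open>S\<close>, and neither is
        \<open>(a, b)\<close>, the cells above, left and north-west of the corner end their
        diagonals in \<open>S\<close>, and \<open>rect\<close> applies to them.\<close>
      have "(Suc a, b) \<notin> S" "(a, Suc b) \<notin> S" "(Suc a, Suc b) \<notin> S"
        using young_down[OF young, of "Suc a" b a b] young_down[OF young, of a "Suc b" a b]
          young_down[OF young, of "Suc a" "Suc b" a b] new pos by auto
      moreover have "(a - 1, b - 1) \<in> S \<or> a - 1 = 0 \<or> b - 1 = 0"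
        "(a - 1, b) \<in> S \<or> a - 1 = 0 \<or> b = 0" "(a, b - 1) \<in> S \<or> a = 0 \<or> b - 1 = 0"
        using pos by (intro below_or_border; simp)+
      moreover have "Suc (a - 1) = a" "Suc (b - 1) = b" using pos by simp_all
      ultimately have "diag (\<Psi> m0) (a - 1) (b - 1) = sum m ({1..a - 1} \<times> {1..b - 1})"
        "diag (\<Psi> m0) (a - 1) b = sum m ({1..a - 1} \<times> {1..b})"
        "diag (\<Psi> m0) a (b - 1) = sum m ({1..a} \<times> {1..b - 1})"
        using rect[of "a - 1" "b - 1"] rect[of "a - 1" b] rect[of a "b - 1"] new by simp_all
      then have "diag (\<Psi>' m) a b = sum m ({1..a} \<times> {1..b})"
        using diag_add_corner[OF \<Psi>[OF m0], of "m (a, b)"] corner_rectangle_sum[OF pos, of m]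
        unfolding \<Psi>'_def m0_def[symmetric] by linarith
      then show ?thesis using 2 by simp
    next
      case 3
      \<comment> \<open>A cell of \<open>S\<close> on the corner's diagonal comes before the corner,
        so it does not end its diagonal in \<open>T\<close> and this case cannot occur.\<close>
      have "x < a"
      proof (rule ccontr)
        assume "\<not> x < a"
        then show False using young_down[OF young 3(1), of a b] 3(2) pos new by auto
      qed
      then have "(Suc x, Suc y) \<in> T"
        using young_down[OF Suc.prems ab(1), of "Suc x" "Suc y"] 3(2) by auto
      then show ?thesis using xy(2) by contradiction
    next
      case 4
      then show ?thesis
        using diag_add_corner_off[OF 4(2)] rect[of x y] xy(2) by (simp add: \<Psi>'_def m0_def T)
    qed
  qed
  ultimately show ?case by blast
qed

subsection \<open>Plane partitions and hook lengths\<close>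

text \<open>Every diagonal ends either in the last column or in the bottom row. The corner
  \<open>(p, q)\<close> belongs to both, hence the half-open range.\<close>

lemma sum_eq_sum_diag:
  assumes "zero_border f"
  shows "sum f ({1..p} \<times> {1..q}) = (\<Sum>i = 1..p. diag f i q) + (\<Sum>j = 1..<q. diag f p j)"
proof (induction q)
  case 0
  then show ?case by simp
next
  case (Suc q)
  have c: "sum f (X \<times> Y) = (\<Sum>i\<in>X. \<Sum>j\<in>Y. f (i, j))" for X Y
    by (simp add: sum.cartesian_product)
  \<comment> \<open>A new column extends all diagonals that ended in column \<open>q\<close> except
    the one ending at \<open>(p, q)\<close>, which moves to the bottom-row sum.\<close>
  have "(\<Sum>i = 1..p. diag f (i - 1) q) + diag f p q = (\<Sum>i = 1..p. diag f i q)"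
    by (induction p) auto
  moreover have "sum f ({1..p} \<times> {1..Suc q}) = (\<Sum>i = 1..p. f (i, Suc q)) + sum f ({1..p} \<times> {1..q})"
    by (simp add: c sum.distrib)
  moreover have "(\<Sum>j = 1..<Suc q. diag f p j) = (\<Sum>j = 1..<q. diag f p j) + diag f p q"
    by (cases q) auto
  ultimately show ?case
    using Suc.IH by (simp add: diag_Suc_right[OF assms] sum.distrib del: sum.op_ivl_Suc)
qed

lemma sum_partial_sums:
  fixes g :: "nat \<Rightarrow> nat"
  shows "(\<Sum>x = 1..p. \<Sum>i = 1..x. g i) = (\<Sum>i = 1..p. (Suc p - i) * g i)"
proof (induction p)
  case (Suc p)
  have "(\<Sum>i = 1..p. (Suc (Suc p) - i) * g i) = (\<Sum>i = 1..p. (Suc p - i) * g i + g i)"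
    by (intro sum.cong) (auto simp: Suc_diff_le algebra_simps)
  then show ?case using Suc by (simp add: sum.distrib)
qed auto

text \<open>The cell \<open>(i, j)\<close> lies in \<open>p + 1 - i\<close> rectangles of the first
  kind and in \<open>q - j\<close> of the second; the total is its hook length.\<close>

lemma sum_rectangles:
  fixes m :: "nat \<times> nat \<Rightarrow> nat"
  shows "(\<Sum>x = 1..p. sum m ({1..x} \<times> {1..q})) + (\<Sum>y = 1..<q. sum m ({1..p} \<times> {1..y})) =
    (\<Sum>(i, j)\<in>{1..p} \<times> {1..q}. (p + q + 1 - i - j) * m (i, j))"
proof -
  have c: "sum m (X \<times> Y) = (\<Sum>i\<in>X. \<Sum>j\<in>Y. m (i, j))" for X Y
    by (simp add: sum.cartesian_product)
  have "(\<Sum>x = 1..p. sum m ({1..x} \<times> {1..q})) = (\<Sum>i = 1..p. (Suc p - i) * (\<Sum>j = 1..q. m (i, j)))"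
    unfolding c by (rule sum_partial_sums)
  moreover have "(\<Sum>y = 1..<q. sum m ({1..p} \<times> {1..y})) = (\<Sum>i = 1..p. \<Sum>j = 1..q. (q - j) * m (i, j))"
  proof -
    have "(\<Sum>y = 1..<q. sum m ({1..p} \<times> {1..y})) = (\<Sum>i = 1..p. \<Sum>y = 1..<q. \<Sum>j = 1..y. m (i, j))"
      unfolding c by (rule sum.swap)
    also have "\<dots> = (\<Sum>i = 1..p. \<Sum>j = 1..q. (q - j) * m (i, j))"
    proof (rule sum.cong[OF refl])
    fix i show "(\<Sum>y = 1..<q. \<Sum>j = 1..y. m (i, j)) = (\<Sum>j = 1..q. (q - j) * m (i, j))"
    proof (cases q)
      case (Suc r)
      have "{1..<q} = {1..r}" using Suc by auto
      then show ?thesis using sum_partial_sums[of "\<lambda>j. m (i, j)" r] Suc by simp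
    qed auto
    qed
    finally show ?thesis .
  qed
  moreover have "(\<Sum>(i, j)\<in>{1..p} \<times> {1..q}. (p + q + 1 - i - j) * m (i, j)) =
     (\<Sum>i = 1..p. \<Sum>j = 1..q. (Suc p - i) * m (i, j) + (q - j) * m (i, j))"
    unfolding sum.cartesian_product[symmetric]
  proof (intro sum.cong refl)
    fix i j assume "i \<in> {1..p}" "j \<in> {1..q}"
    then have "p + q + 1 - i - j = (Suc p - i) + (q - j)" by auto
    then show "(p + q + 1 - i - j) * m (i, j) = (Suc p - i) * m (i, j) + (q - j) * m (i, j)"
      by (simp only: add_mult_distrib)
  qed
  ultimately show ?thesis by (simp add: sum.distrib sum_distrib_left)
qed

text \<open>The bijection of \<open>fillings_rpp_bij\<close> turns the size of a reverse plane
  partition, split into diagonals, into the hook-weighted sum of its filling.\<close>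

lemma rpp_rectangle_card:
  fixes p q N :: nat
  defines "B \<equiv> {1..p} \<times> {1..q}"
  shows "card {f \<in> rpp B. sum f B = N} =
    card {m \<in> fillings B. (\<Sum>(i, j)\<in>B. (p + q + 1 - i - j) * m (i, j)) = N}"
proof -
  have "young B" by (auto simp: young_def B_def)
  then obtain \<Psi> where bij: "bij_betw \<Psi> (fillings B) (rpp B)"
    and diag: "\<And>m x y. m \<in> fillings B \<Longrightarrow> (x, y) \<in> B \<or> x = 0 \<or> y = 0 \<Longrightarrow> (Suc x, Suc y) \<notin> B \<Longrightarrow>
       diag (\<Psi> m) x y = sum m ({1..x} \<times> {1..y})"
    using fillings_rpp_bij[of B] by blast
  have wt: "sum (\<Psi> m) B = (\<Sum>(i, j)\<in>B. (p + q + 1 - i - j) * m (i, j))" if m: "m \<in> fillings B" for m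
  proof -
    have "\<Psi> m \<in> rpp B" using bij m by (auto simp: bij_betw_def)
    then have "zero_border (\<Psi> m)" by (auto simp: rpp_def fillings_def zero_border_def B_def)
    then have "sum (\<Psi> m) B = (\<Sum>i = 1..p. diag (\<Psi> m) i q) + (\<Sum>j = 1..<q. diag (\<Psi> m) p j)"
      unfolding B_def by (rule sum_eq_sum_diag)
    also have "(\<Sum>i = 1..p. diag (\<Psi> m) i q) = (\<Sum>i = 1..p. sum m ({1..i} \<times> {1..q}))"
      by (intro sum.cong refl diag[OF m]) (auto simp: B_def)
    also have "(\<Sum>j = 1..<q. diag (\<Psi> m) p j) = (\<Sum>j = 1..<q. sum m ({1..p} \<times> {1..j}))"
      by (intro sum.cong refl diag[OF m]) (auto simp: B_def)
    finally show ?thesis by (simp only: sum_rectangles B_def)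
  qed
  have "bij_betw \<Psi> {m \<in> fillings B. (\<Sum>(i, j)\<in>B. (p + q + 1 - i - j) * m (i, j)) = N} {f \<in> rpp B. sum f B = N}"
    using bij wt by (intro bij_betw_Collect) auto
  then show ?thesis by (simp add: bij_betw_same_card)
qed

lemma rpp_rectangle_mono:
  assumes f: "f \<in> rpp ({1..p} \<times> {1..q})" and le: "i \<le> i'" "j \<le> j'" "1 \<le> i" "1 \<le> j" "i' \<le> p" "j' \<le> q"
  shows "f (i, j) \<le> f (i', j')"
proof -
  have "f (i, j) \<le> f (i', j)"
    using le(1) le(5)
  proof (induction i' rule: dec_induct)
    case (step k)
    then show ?case using rpp_down[OF f, of k j] le by fastforce
  qed simp
  also have "f (i', j) \<le> f (i', j')"
    using le(2) le(6)
  proof (induction j' rule: dec_induct)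
    case (step k)
    then show ?case using rpp_right[OF f, of i' k] le by fastforce
  qed simp
  finally show ?thesis .
qed

text \<open>Rotating the square by 180 degrees, which is \<open>r\<close>, exchanges weakly
  decreasing and weakly increasing arrays.\<close>

lemma pp_eq_card_rpp:
  "pp n = card {f \<in> rpp ({1..n} \<times> {1..n}). sum f ({1..n} \<times> {1..n}) = n}"
proof -
  define B where "B = {1..n} \<times> {1..n}"
  define r where "r = (\<lambda>(i, j). (Suc n - i, Suc n - j))"
  have r: "r c \<in> B" "r (r c) = c" if "c \<in> B" for c
    using that by (auto simp: r_def B_def)
  have rB: "bij_betw r B B"
    by (rule bij_betw_byWitness[where f' = r]) (use r in auto)
  \<comment> \<open>Besides rotating, \<open>\<Phi>\<close> and \<open>\<Theta>\<close> exchange the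
    default outside the square: \<open>undefined\<close> for plane partitions, \<open>0\<close> for
    fillings.\<close>
  define \<Phi> where "\<Phi> p = (\<lambda>c. if c \<in> B then p (r c) else 0)" for p :: "nat \<times> nat \<Rightarrow> nat"
  define \<Theta> where "\<Theta> f = restrict (\<lambda>c. f (r c)) B" for f :: "nat \<times> nat \<Rightarrow> nat"
  have tot: "sum (\<lambda>c. p (r c)) B = sum p B" for p :: "nat \<times> nat \<Rightarrow> nat"
    by (rule sum.reindex_bij_betw[OF rB])
  have PP: "p \<in> plane_partitions n \<longleftrightarrow> p \<in> extensional B \<and> sum p B = n \<and>
      (\<forall>i j i' j'. (i, j) \<in> B \<longrightarrow> (i', j') \<in> B \<longrightarrow> i \<le> i' \<longrightarrow> j \<le> j' \<longrightarrow> p (i', j') \<le> p (i, j))" for p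
  proof -
    have "(\<Sum>(i, j)\<in>{1..n} \<times> {1..n}. p (i, j)) = sum p B"
      by (simp add: B_def split_def)
    moreover have "(\<forall>i\<in>{1..n}. \<forall>j\<in>{1..n}. \<forall>i'\<in>{1..n}. \<forall>j'\<in>{1..n}.
        i \<le> i' \<and> j \<le> j' \<longrightarrow> p (i', j') \<le> p (i, j)) \<longleftrightarrow>
      (\<forall>i j i' j'. (i, j) \<in> B \<longrightarrow> (i', j') \<in> B \<longrightarrow> i \<le> i' \<longrightarrow> j \<le> j' \<longrightarrow> p (i', j') \<le> p (i, j))"
      unfolding B_def mem_Times_iff fst_conv snd_conv by blast
    ultimately show ?thesis
      unfolding plane_partitions_def PiE_def by (simp add: B_def)
  qed
  have "bij_betw \<Phi> (plane_partitions n) {f \<in> rpp B. sum f B = n}"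
  proof (rule bij_betw_byWitness[where f' = \<Theta>])
    show "\<forall>p\<in>plane_partitions n. \<Theta> (\<Phi> p) = p"
      by (auto simp: \<Theta>_def \<Phi>_def PP r intro: extensionalityI[of _ B])
    show "\<forall>f\<in>{f \<in> rpp B. sum f B = n}. \<Phi> (\<Theta> f) = f"
      by (auto simp: \<Theta>_def \<Phi>_def r fun_eq_iff rpp_def fillings_def)
    show "\<Phi> ` plane_partitions n \<subseteq> {f \<in> rpp B. sum f B = n}"
    proof
      fix g assume "g \<in> \<Phi> ` plane_partitions n"
      then obtain p where g: "g = \<Phi> p" and p: "p \<in> plane_partitions n" by blast
      have mono: "\<Phi> p (i, j) \<le> \<Phi> p (i', j')" if "(i', j') \<in> B" "i \<le> i'" "j \<le> j'" for i j i' j'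
      proof (cases "(i, j) \<in> B")
        case True
        have "(Suc n - i', Suc n - j') \<in> B" "(Suc n - i, Suc n - j) \<in> B"
          using r(1)[OF True] r(1)[OF that(1)] by (auto simp: r_def)
        then show ?thesis using p that True unfolding PP by (simp add: \<Phi>_def r_def)
      qed (simp add: \<Phi>_def)
      have "sum (\<Phi> p) B = n" using p tot[of p] by (simp add: \<Phi>_def PP)
      moreover have "\<Phi> p \<in> rpp B"
        unfolding rpp_def fillings_def using mono by (auto simp: \<Phi>_def)
      ultimately show "g \<in> {f \<in> rpp B. sum f B = n}" unfolding g by blast
    qed
    show "\<Theta> ` {f \<in> rpp B. sum f B = n} \<subseteq> plane_partitions n"
    proof
      fix g assume "g \<in> \<Theta> ` {f \<in> rpp B. sum f B = n}"
      then obtain f where g: "g = \<Theta> f" and f: "f \<in> rpp B" and n: "sum f B = n" by blast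
      have "\<Theta> f (i', j') \<le> \<Theta> f (i, j)" if "(i, j) \<in> B" "(i', j') \<in> B" "i \<le> i'" "j \<le> j'" for i j i' j'
        using rpp_rectangle_mono[OF f[unfolded B_def], of "Suc n - i'" "Suc n - i" "Suc n - j'" "Suc n - j"] that
        by (auto simp: \<Theta>_def r_def B_def)
      moreover have "sum (\<Theta> f) B = n" using tot[of f] n by (simp add: \<Theta>_def)
      moreover have "\<Theta> f \<in> extensional B" by (simp add: \<Theta>_def)
      ultimately show "g \<in> plane_partitions n" unfolding g PP by blast
    qed
  qed
  then show ?thesis unfolding pp_def B_def by (rule bij_betw_same_card)
qed

section \<open>Counting fillings with a prescribed weighted sum\<close>

lemma bij_betw_count_fillings:
  assumes "finite C"
  shows "bij_betw count (multisets_of_size C k) {g \<in> fillings C. sum g C = k}"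
  unfolding bij_betw_def
proof
    show "inj_on count (multisets_of_size C k)" by (auto simp: inj_on_def multiset_eq_iff)
    show "count ` multisets_of_size C k = {g \<in> fillings C. sum g C = k}"
    proof (intro equalityI subsetI)
      fix g assume "g \<in> count ` multisets_of_size C k"
      then obtain M where M: "set_mset M \<subseteq> C" "size M = k" "g = count M"
        by (auto simp: multisets_of_size_def)
      have "size M = sum (count M) C"
        unfolding size_multiset_overloaded_eq
        by (rule sum.mono_neutral_left) (use assms M in \<open>auto simp: not_in_iff\<close>)
      then show "g \<in> {g \<in> fillings C. sum g C = k}"
        using M by (auto simp: fillings_def not_in_iff[symmetric])
    next
      fix g assume g: "g \<in> {g \<in> fillings C. sum g C = k}"
      define M where "M = (\<Sum>c\<in>C. replicate_mset (g c) c)"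
      have "count M x = (if x \<in> C then g x else 0)" for x
        using assms by (simp add: M_def count_sum count_replicate_mset sum.delta)
      then have "count M = g" using g by (auto simp: fillings_def fun_eq_iff)
      moreover have "set_mset M \<subseteq> C" using \<open>count M = g\<close> g by (auto simp: fillings_def count_eq_zero_iff)
      moreover have "size M = k" using g by (simp add: M_def size_multiset_sum)
      ultimately show "g \<in> count ` multisets_of_size C k" by (auto simp: multisets_of_size_def)
    qed
qed

text \<open>Stars and bars. With truncated subtraction the formula is right for empty
  \<open>C\<close> too: \<open>1\<close> for \<open>k = 0\<close> and \<open>0\<close>
  otherwise.\<close>

lemma card_fillings_sum:
  assumes "finite C"
  shows "card {g \<in> fillings C. sum g C = k} = (k + card C - 1) choose k"
  using bij_betw_same_card[OF bij_betw_count_fillings[OF assms, of k]] card_multisets_of_size[OF assms, of k]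
  by (simp add: add.commute)

lemma finite_fillings_sum: "finite C \<Longrightarrow> finite {g \<in> fillings C. sum g C = k}"
  using bij_betw_finite[OF bij_betw_count_fillings[of C k]] finite_multisets_of_size[of C k] by simp

lemma finite_A: "finite (A n)"
proof (rule finite_subset)
  show "A n \<subseteq> {1..n} \<rightarrow>\<^sub>E {..n}"
  proof
    fix l assume l: "l \<in> A n"
    have "l s \<le> n" if "s \<in> {1..n}" for s
    proof -
      have "l s \<le> s * l s" using that by simp
      also have "\<dots> \<le> (\<Sum>s = 1..n. s * l s)" using that by (intro member_le_sum) auto
      finally show ?thesis using l by (simp add: A_def)
    qed
    then show "l \<in> {1..n} \<rightarrow>\<^sub>E {..n}" using l by (auto simp: A_def PiE_def)
  qed
qed (auto intro: finite_PiE)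

text \<open>Cells are grouped by weight: \<open>l s\<close> is the total carried by the cells of
  weight \<open>s\<close>, and the groups are filled independently of each other.\<close>

lemma card_weighted_fillings:
  fixes h :: "'a \<Rightarrow> nat"
  assumes fin: "finite S" and h: "\<And>c. c \<in> S \<Longrightarrow> 1 \<le> h c"
  shows "card {m \<in> fillings S. (\<Sum>c\<in>S. h c * m c) = n} =
    (\<Sum>l\<in>A n. \<Prod>s = 1..n. (l s + card {c \<in> S. h c = s} - 1) choose l s)"
proof -
  define C where "C s = {c \<in> S. h c = s}" for s
  define G where "G s k = {g \<in> fillings (C s). sum g (C s) = k}" for s k
  \<comment> \<open>Cells of weight above \<open>n\<close> have no coordinate in \<open>l\<close>,
    so their vanishing is demanded separately.\<close>
  define F where "F l = {m \<in> fillings S. (\<forall>c\<in>S. n < h c \<longrightarrow> m c = 0) \<and> (\<forall>s\<in>{1..n}. sum m (C s) = l s)}" for l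
  have finC: "finite (C s)" for s using fin by (simp add: C_def)
  have wt: "(\<Sum>c\<in>S. h c * m c) = (\<Sum>s = 1..n. s * sum m (C s))" if "\<forall>c\<in>S. n < h c \<longrightarrow> m c = 0" for m
  proof -
    define S0 where "S0 = {c \<in> S. h c \<le> n}"
    have "(\<Sum>c\<in>S. h c * m c) = (\<Sum>c\<in>S0. h c * m c)"
      by (rule sum.mono_neutral_right) (use fin that in \<open>auto simp: S0_def\<close>)
    also have "\<dots> = (\<Sum>s = 1..n. \<Sum>c\<in>{c \<in> S0. h c = s}. h c * m c)"
      by (rule sum.group[symmetric]) (use fin h in \<open>auto simp: S0_def\<close>)
    also have "\<dots> = (\<Sum>s = 1..n. s * sum m (C s))"
    proof (rule sum.cong[OF refl])
      fix s assume "s \<in> {1..n}"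
      then have "{c \<in> S0. h c = s} = C s" by (auto simp: S0_def C_def)
      then show "(\<Sum>c\<in>{c \<in> S0. h c = s}. h c * m c) = s * sum m (C s)"
        by (simp add: sum_distrib_left C_def)
    qed
    finally show ?thesis .
  qed
  have U: "{m \<in> fillings S. (\<Sum>c\<in>S. h c * m c) = n} = (\<Union>l\<in>A n. F l)"
  proof (intro equalityI subsetI)
    fix m assume m: "m \<in> {m \<in> fillings S. (\<Sum>c\<in>S. h c * m c) = n}"
    have z: "\<forall>c\<in>S. n < h c \<longrightarrow> m c = 0"
    proof (intro ballI impI)
      fix c assume c: "c \<in> S" "n < h c"
      have "h c * m c \<le> (\<Sum>c\<in>S. h c * m c)" using fin c by (intro member_le_sum) auto
      also have "\<dots> < h c * 1" using m c by simp
      finally show "m c = 0" by (simp only: mult_less_cancel1) simp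
    qed
    define l where "l = restrict (\<lambda>s. sum m (C s)) {1..n}"
    have "l \<in> A n" using wt[OF z] m by (simp add: A_def l_def)
    moreover have "m \<in> F l" using m z by (simp add: F_def l_def)
    ultimately show "m \<in> (\<Union>l\<in>A n. F l)" by blast
  next
    fix m assume "m \<in> (\<Union>l\<in>A n. F l)"
    then obtain l where "l \<in> A n" "m \<in> F l" by blast
    then show "m \<in> {m \<in> fillings S. (\<Sum>c\<in>S. h c * m c) = n}"
      using wt[of m] by (simp add: F_def A_def)
  qed
  have bij: "bij_betw (\<lambda>m. \<lambda>s\<in>{1..n}. \<lambda>c. if c \<in> C s then m c else 0) (F l) (PiE {1..n} (\<lambda>s. G s (l s)))" for l
  \<comment> \<open>The inverse glues the pieces: the value at \<open>c\<close> is read from the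
    piece for the weight \<open>h c\<close>.\<close>
  proof (rule bij_betw_byWitness[where f' = "\<lambda>g c. if c \<in> S \<and> h c \<le> n then g (h c) c else 0"])
    show "\<forall>m\<in>F l. (\<lambda>c. if c \<in> S \<and> h c \<le> n
        then (\<lambda>s\<in>{1..n}. \<lambda>c. if c \<in> C s then m c else 0) (h c) c else 0) = m"
    proof (intro ballI ext)
      fix m c assume m: "m \<in> F l"
      show "(if c \<in> S \<and> h c \<le> n
        then (\<lambda>s\<in>{1..n}. \<lambda>c. if c \<in> C s then m c else 0) (h c) c else 0) = m c"
      proof (cases "c \<in> S \<and> h c \<le> n")
        case True
        then show ?thesis using h[of c] by (simp add: C_def)
      next
        case False
        then have "m c = 0" using m by (auto simp: F_def fillings_def not_le)
        then show ?thesis using False by auto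
      qed
    qed
    show "\<forall>g\<in>PiE {1..n} (\<lambda>s. G s (l s)).
        (\<lambda>s\<in>{1..n}. \<lambda>c. if c \<in> C s then (if c \<in> S \<and> h c \<le> n then g (h c) c else 0) else 0) = g"
    proof
      fix g assume g: "g \<in> PiE {1..n} (\<lambda>s. G s (l s))"
      show "(\<lambda>s\<in>{1..n}. \<lambda>c. if c \<in> C s then (if c \<in> S \<and> h c \<le> n then g (h c) c else 0) else 0) = g"
      proof (rule extensionalityI[of _ "{1..n}"])
        fix s assume s: "s \<in> {1..n}"
        then have "g s \<in> fillings (C s)" using g by (auto simp: G_def)
        then show "(\<lambda>s\<in>{1..n}. \<lambda>c. if c \<in> C s then (if c \<in> S \<and> h c \<le> n then g (h c) c else 0) else 0) s = g s"
          using s by (intro ext) (auto simp: fillings_def C_def)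
      qed (use g in \<open>auto simp: PiE_def\<close>)
    qed
    show "(\<lambda>m. \<lambda>s\<in>{1..n}. \<lambda>c. if c \<in> C s then m c else 0) ` F l \<subseteq> PiE {1..n} (\<lambda>s. G s (l s))"
      by (auto simp: F_def G_def fillings_def)
    show "(\<lambda>g c. if c \<in> S \<and> h c \<le> n then g (h c) c else 0) ` PiE {1..n} (\<lambda>s. G s (l s)) \<subseteq> F l"
    proof
      fix m assume "m \<in> (\<lambda>g c. if c \<in> S \<and> h c \<le> n then g (h c) c else 0) ` PiE {1..n} (\<lambda>s. G s (l s))"
      then obtain g where g: "g \<in> PiE {1..n} (\<lambda>s. G s (l s))"
        and m: "m = (\<lambda>c. if c \<in> S \<and> h c \<le> n then g (h c) c else 0)" by blast
      have "sum m (C s) = l s" if s: "s \<in> {1..n}" for s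
      proof -
        have "sum m (C s) = sum (g s) (C s)" using s by (intro sum.cong) (auto simp: m C_def)
        also have "\<dots> = l s" using PiE_mem[OF g s] by (simp add: G_def)
        finally show ?thesis .
      qed
      then show "m \<in> F l" by (auto simp: F_def fillings_def m)
    qed
  qed
  have finF: "finite (F l)" for l
    using bij_betw_finite[OF bij[of l]] finite_fillings_sum[OF finC] by (simp add: G_def finite_PiE)
  have cardF: "card (F l) = (\<Prod>s = 1..n. (l s + card (C s) - 1) choose l s)" for l
    using bij_betw_same_card[OF bij[of l]] by (simp add: card_PiE G_def card_fillings_sum[OF finC])
  have disj: "F l \<inter> F l' = {}" if "l \<in> A n" "l' \<in> A n" "l \<noteq> l'" for l l'
  proof (rule ccontr)
    assume "F l \<inter> F l' \<noteq> {}"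
    then have "\<forall>s\<in>{1..n}. l s = l' s" by (auto simp: F_def)
    then have "l = l'" using that by (intro extensionalityI[of l "{1..n}"]) (auto simp: A_def PiE_def)
    then show False using that by simp
  qed
  have "card (\<Union>l\<in>A n. F l) = (\<Sum>l\<in>A n. card (F l))"
    using finite_A finF disj by (intro card_UN_disjoint) auto
  then show ?thesis by (simp add: U cardF C_def)
qed

text \<open>These cells form the antidiagonal \<open>i + j = 2 * n + 1 - s\<close>, which for
  \<open>s \<le> n\<close> meets exactly the last \<open>s\<close> rows of the square.\<close>

lemma card_square_hooks:
  assumes "1 \<le> s" "s \<le> n"
  shows "card {c \<in> {1..n} \<times> {1..n}. (case c of (i, j) \<Rightarrow> n + n + 1 - i - j) = s} = s"
proof -
  have "{c \<in> {1..n} \<times> {1..n}. (case c of (i, j) \<Rightarrow> n + n + 1 - i - j) = s} =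
      (\<lambda>i. (i, n + n + 1 - s - i)) ` {n + 1 - s..n}"
    using assms by (auto simp: image_iff)
  also have "card \<dots> = card {n + 1 - s..n}" by (intro card_image) (auto simp: inj_on_def)
  finally show ?thesis using assms by simp
qed

text \<open>The right side is the coefficient of \<open>x^n\<close> in the product of all
  \<open>1 / (1 - x^s)^s\<close>; \<open>l s\<close> is the exponent of \<open>x^s\<close> taken
  from factor \<open>s\<close>.\<close>

theorem MacMahon_pp:
  "pp n = (\<Sum>l\<in>A n. \<Prod>s = 1..n. (l s + s - 1) choose l s)"
proof -
  let ?h = "\<lambda>(i, j). n + n + 1 - i - j"
  have "pp n = card {m \<in> fillings ({1..n} \<times> {1..n}). (\<Sum>c\<in>{1..n} \<times> {1..n}. ?h c * m c) = n}"
    unfolding pp_eq_card_rpp rpp_rectangle_card by (simp add: split_def)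
  also have "\<dots> = (\<Sum>l\<in>A n. \<Prod>s = 1..n. (l s + card {c \<in> {1..n} \<times> {1..n}. ?h c = s} - 1) choose l s)"
    by (rule card_weighted_fillings) auto
  also have "\<dots> = (\<Sum>l\<in>A n. \<Prod>s = 1..n. (l s + s - 1) choose l s)"
    by (intro sum.cong prod.cong refl, subst card_square_hooks) auto
  finally show ?thesis .
qed

section \<open>Collapse of the inner sums\<close>

lemma D_gt:
  assumes "n \<ge> 3"
  shows "n < D n"
proof -
  have "n dvd D n" "n - 1 dvd D n" using assms by (auto simp: D_def intro!: dvd_Lcm)
  moreover have "coprime n (n - 1)" using assms coprime_diff_one_right_nat[of n] by simp
  ultimately have "n * (n - 1) dvd D n" by (intro divides_mult)
  moreover have "D n \<noteq> 0" by (simp add: D_def Lcm_0_iff)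
  ultimately have "n * (n - 1) \<le> D n" by (intro dvd_imp_le) auto
  moreover have "n * 1 < n * (n - 1)" using assms by (intro mult_strict_left_mono) auto
  ultimately show ?thesis by linarith
qed

text \<open>Clearing denominators gives \<open>i * D n + j * s = s * m\<close>, and the right side
  is too small for \<open>i > 0\<close>.\<close>

lemma index_pairs_eq:
  assumes "1 \<le> s" "s * m < D n"
  shows "index_pairs n s m = {(0, m)}"
proof -
  have "(of_nat (i * D n) / of_nat s + of_nat j :: rat) = of_nat m \<longleftrightarrow> i = 0 \<and> j = m" for i j
  proof -
    have "(of_nat (i * D n) / of_nat s + of_nat j :: rat) = of_nat m \<longleftrightarrow>
        (of_nat (i * D n + j * s) :: rat) = of_nat (s * m)"
      using assms(1) by (simp add: field_simps)
    also have "\<dots> \<longleftrightarrow> i * D n + j * s = s * m" by (rule of_nat_eq_iff)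
    also have "\<dots> \<longleftrightarrow> i = 0 \<and> j = m"
      using assms by (cases i) auto
    finally show ?thesis .
  qed
  then show ?thesis by (auto simp: index_pairs_def)
qed

theorem theorem2p2:
  fixes n :: nat
  assumes "n \<ge> 3"
  shows "int (pp n) =
    (\<Sum>l\<in>A n. \<Prod>s = 2..n. \<Sum>(i, j)\<in>index_pairs n s (l s).
       (- 1) ^ i * int (s choose i) * int ((j + s - 1) choose j))"
proof -
  have "(\<Prod>s = 2..n. \<Sum>(i, j)\<in>index_pairs n s (l s).
       (- 1) ^ i * int (s choose i) * int ((j + s - 1) choose j)) =
     int (\<Prod>s = 1..n. (l s + s - 1) choose l s)" if l: "l \<in> A n" for l
  proof -
    have "index_pairs n s (l s) = {(0, l s)}" if s: "s \<in> {2..n}" for s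
    proof (rule index_pairs_eq)
      have "s * l s \<le> (\<Sum>s = 1..n. s * l s)" using s by (intro member_le_sum) auto
      also have "\<dots> < D n" using l D_gt[OF assms] by (simp add: A_def)
      finally show "s * l s < D n" .
    qed (use s in auto)
    \<comment> \<open>The factor for \<open>s = 1\<close> is \<open>l 1 choose l 1\<close>, which is
      \<open>1\<close>, so the product may start at \<open>2\<close>.\<close>
    moreover have "{1..n} = insert 1 {2..n}" using assms by auto
    ultimately show ?thesis by simp
  qed
  then show ?thesis by (simp add: MacMahon_pp)
qed

end
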